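(* Let $S$ be a recurrent specular set on the finite alphabet $A$. For any nonempty $w\in S$ such that $w$ and $w^{-1}$ do not overlap, the set $\mathcal{MR}_S(w)$ of mixed return words to $w$ in $S$ has $\mathrm{Card}(A)$ elements.
   Context: Words are over a finite alphabet $A$; $\varepsilon$ is the empty word. A set $S$ of words on $A$ is factorial if it contains $A$ and all the factors of its elements. For $w\in S$ let $L(w)=\{a\in A\mid aw\in S\}$, $R(w)=\{a\in A\mid wa\in S\}$, $B(w)=\{(a,b)\in A\times A\mid awb\in S\}$. A factorial set $S$ is biextendable if $B(w)\neq\emptyset$ for all $w\in S$. The extension graph $\mathcal{E}(w)$ is the undirected graph whose vertex set is the disjoint union of $L(w)$ and $R(w)$ and whose edges are the pairs in $B(w)$. A biextendable set $S$ is a tree set of characteristic $c$ if $\mathcal{E}(w)$ is a tree for every nonempty $w\in S$ and $\mathcal{E}(\varepsilon)$ is a disjoint union of $c$ trees. Let $\theta$ be an involution on $A$ (possibly with fixed points) and let $G_\theta$ be the group generated by $A$ with relations $a\theta(a)=1$, $a\in A$ (so $a^{-1}=\theta(a)$). A word is reduced if it has no factor $a\theta(a)$ with $a\in A$; the inverse $w^{-1}$ of a reduced word $w=a_1\cdots a_n$ is the reduced word $\theta(a_n)\cdots\theta(a_1)$. A laminary set on $A$ relative to $\theta$ is a biextendable set of reduced words closed under taking inverses. A specular set is a laminary set which is a tree set of characteristic $2$. A set $S\ne\{\varepsilon\}$ is recurrent if it is factorial and for all $u,w\in S$ there is $v\in S$ with $uvw\in S$. For a set $X\subset S$ of nonempty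 words, a complete return word to $X$ is a word of $S$ with a proper prefix in $X$, a proper suffix in $X$ but no internal factor in $X$ ($v$ is an internal factor of $y$ if $y=uvw$ with $u,w$ nonempty). Two words $u,v$ overlap if a nonempty suffix of one of them is a prefix of the other. If $w,w^{-1}$ do not overlap, with each complete return word $u$ to $\{w,w^{-1}\}$ one associates the word $N(u)$ obtained from $u$ by erasing the prefix $w$ if $u$ has $w$ as a prefix, and erasing the suffix $w^{-1}$ if $u$ has $w^{-1}$ as a suffix. The set $\mathcal{MR}_S(w)$ of mixed return words to $w$ is the set of words $N(u)$ for $u$ a complete return word to $\{w,w^{-1}\}$. *)

theory Defs
  imports Main "HOL-Library.Sublist" "HOL-Library.Disjoint_Sets"
begin

section \<open>Undirected simple graphs, trees and disjoint unions of trees\<close>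

text \<open>
  A graph is given by a vertex set \<open>V\<close> and a set \<open>E\<close> of two-element subsets of \<open>V\<close>.
\<close>

definition simple_graph :: "'v set \<Rightarrow> 'v set set \<Rightarrow> bool" where
  "simple_graph V E \<longleftrightarrow> (\<forall>e\<in>E. e \<subseteq> V \<and> card e = 2)"

definition graph_walk :: "'v set \<Rightarrow> 'v set set \<Rightarrow> 'v list \<Rightarrow> bool" where
  "graph_walk V E p \<longleftrightarrow> p \<noteq> [] \<and> set p \<subseteq> V \<and> successively (\<lambda>x y. {x, y} \<in> E) p"

definition graph_connected :: "'v set \<Rightarrow> 'v set set \<Rightarrow> bool" where
  "graph_connected V E \<longleftrightarrow>
     V \<noteq> {} \<and> (\<forall>x\<in>V. \<forall>y\<in>V. \<exists>p. graph_walk V E p \<and> hd p = x \<and> last p = y)"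

text \<open>A cycle is listed by its pairwise distinct vertices; the last edge closes it.\<close>

definition graph_cycle :: "'v set \<Rightarrow> 'v set set \<Rightarrow> 'v list \<Rightarrow> bool" where
  "graph_cycle V E p \<longleftrightarrow>
     graph_walk V E p \<and> distinct p \<and> 3 \<le> length p \<and> {last p, hd p} \<in> E"

definition tree_graph :: "'v set \<Rightarrow> 'v set set \<Rightarrow> bool" where
  "tree_graph V E \<longleftrightarrow>
     simple_graph V E \<and> graph_connected V E \<and> \<not> (\<exists>p. graph_cycle V E p)"

definition disjoint_union_of_trees :: "nat \<Rightarrow> 'v set \<Rightarrow> 'v set set \<Rightarrow> bool" where
  "disjoint_union_of_trees c V E \<longleftrightarrow>
     (\<exists>VT ET. (\<forall>i<c. tree_graph (VT i) (ET i)) \<and> disjoint_family_on VT {..<c} \<and>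
        V = (\<Union>i<c. VT i) \<and> E = (\<Union>i<c. ET i))"

section \<open>Factorial, recurrent, biextendable and tree sets\<close>

definition factorial_set :: "'a set \<Rightarrow> 'a list set \<Rightarrow> bool" where
  "factorial_set A S \<longleftrightarrow>
     S \<subseteq> lists A \<and> (\<forall>a\<in>A. [a] \<in> S) \<and> (\<forall>u\<in>S. \<forall>v. sublist v u \<longrightarrow> v \<in> S)"

definition recurrent_set :: "'a set \<Rightarrow> 'a list set \<Rightarrow> bool" where
  "recurrent_set A S \<longleftrightarrow>
     S \<noteq> {[]} \<and> factorial_set A S \<and> (\<forall>u\<in>S. \<forall>w\<in>S. \<exists>v\<in>S. u @ v @ w \<in> S)"

definition left_ext :: "'a set \<Rightarrow> 'a list set \<Rightarrow> 'a list \<Rightarrow> 'a set" where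
  "left_ext A S w = {a \<in> A. a # w \<in> S}"

definition right_ext :: "'a set \<Rightarrow> 'a list set \<Rightarrow> 'a list \<Rightarrow> 'a set" where
  "right_ext A S w = {a \<in> A. w @ [a] \<in> S}"

definition bi_ext :: "'a set \<Rightarrow> 'a list set \<Rightarrow> 'a list \<Rightarrow> ('a \<times> 'a) set" where
  "bi_ext A S w = {(a, b) \<in> A \<times> A. a # w @ [b] \<in> S}"

definition biextendable_set :: "'a set \<Rightarrow> 'a list set \<Rightarrow> bool" where
  "biextendable_set A S \<longleftrightarrow> factorial_set A S \<and> (\<forall>w\<in>S. bi_ext A S w \<noteq> {})"

definition ext_graph_verts :: "'a set \<Rightarrow> 'a list set \<Rightarrow> 'a list \<Rightarrow> ('a + 'a) set" where
  "ext_graph_verts A S w = left_ext A S w <+> right_ext A S w"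

definition ext_graph_edges :: "'a set \<Rightarrow> 'a list set \<Rightarrow> 'a list \<Rightarrow> ('a + 'a) set set" where
  "ext_graph_edges A S w = {{Inl a, Inr b} | a b. (a, b) \<in> bi_ext A S w}"

definition tree_set :: "'a set \<Rightarrow> nat \<Rightarrow> 'a list set \<Rightarrow> bool" where
  "tree_set A c S \<longleftrightarrow> biextendable_set A S \<and>
     (\<forall>w\<in>S. w \<noteq> [] \<longrightarrow> tree_graph (ext_graph_verts A S w) (ext_graph_edges A S w)) \<and>
     disjoint_union_of_trees c (ext_graph_verts A S []) (ext_graph_edges A S [])"

section \<open>Laminary and specular sets\<close>

definition involution_on :: "'a set \<Rightarrow> ('a \<Rightarrow> 'a) \<Rightarrow> bool" where
  "involution_on A \<theta> \<longleftrightarrow> (\<forall>a\<in>A. \<theta> a \<in> A \<and> \<theta> (\<theta> a) = a)"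

definition reduced_word :: "'a set \<Rightarrow> ('a \<Rightarrow> 'a) \<Rightarrow> 'a list \<Rightarrow> bool" where
  "reduced_word A \<theta> w \<longleftrightarrow> w \<in> lists A \<and> \<not> (\<exists>a\<in>A. sublist [a, \<theta> a] w)"

text \<open>
  For a reduced word this is the reduced word representing the inverse in the group generated
  by \<open>A\<close> with relations \<open>a \<theta>(a) = 1\<close>.
\<close>

definition word_inv :: "('a \<Rightarrow> 'a) \<Rightarrow> 'a list \<Rightarrow> 'a list" where
  "word_inv \<theta> w = rev (map \<theta> w)"

definition laminary_set :: "'a set \<Rightarrow> ('a \<Rightarrow> 'a) \<Rightarrow> 'a list set \<Rightarrow> bool" where
  "laminary_set A \<theta> S \<longleftrightarrow>
     biextendable_set A S \<and> (\<forall>w\<in>S. reduced_word A \<theta> w) \<and> (\<forall>w\<in>S. word_inv \<theta> w \<in> S)"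

definition specular_set :: "'a set \<Rightarrow> ('a \<Rightarrow> 'a) \<Rightarrow> 'a list set \<Rightarrow> bool" where
  "specular_set A \<theta> S \<longleftrightarrow> laminary_set A \<theta> S \<and> tree_set A 2 S"

section \<open>Complete and mixed return words\<close>

definition internal_factor :: "'a list \<Rightarrow> 'a list \<Rightarrow> bool" where
  "internal_factor v y \<longleftrightarrow> (\<exists>u w. u \<noteq> [] \<and> w \<noteq> [] \<and> y = u @ v @ w)"

definition complete_return_words :: "'a list set \<Rightarrow> 'a list set \<Rightarrow> 'a list set" where
  "complete_return_words S X = {u \<in> S. (\<exists>x\<in>X. strict_prefix x u) \<and>
     (\<exists>x\<in>X. strict_suffix x u) \<and> \<not> (\<exists>x\<in>X. internal_factor x u)}"

definition words_overlap :: "'a list \<Rightarrow> 'a list \<Rightarrow> bool" where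
  "words_overlap u v \<longleftrightarrow>
     (\<exists>s. s \<noteq> [] \<and> (suffix s u \<and> prefix s v \<or> suffix s v \<and> prefix s u))"

text \<open>
  Both tests below refer to the original word \<open>u\<close>. If \<open>w\<close> and its inverse do not overlap, then a
  prefix \<open>w\<close> and a suffix \<open>word_inv \<theta> w\<close> of \<open>u\<close> occupy disjoint positions, so the two
  erasures are independent.
\<close>

definition mixed_erase :: "('a \<Rightarrow> 'a) \<Rightarrow> 'a list \<Rightarrow> 'a list \<Rightarrow> 'a list" where
  "mixed_erase \<theta> w u =
     (let u' = (if prefix w u then drop (length w) u else u)
      in if suffix (word_inv \<theta> w) u then take (length u' - length w) u' else u')"

definition mixed_return_words :: "('a \<Rightarrow> 'a) \<Rightarrow> 'a list set \<Rightarrow> 'a list \<Rightarrow> 'a list set" where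
  "mixed_return_words \<theta> S w = mixed_erase \<theta> w ` complete_return_words S {w, word_inv \<theta> w}"

end

theory Submission
  imports Defs
begin

text \<open>
  Give a word \<open>u\<close> of \<open>S\<close> the weight \<open>card R(u) - 1\<close>, or \<open>card R(u) - c\<close> if \<open>u\<close> is empty. Since a tree
  has one edge less than it has vertices, the weight of \<open>u\<close> is the sum of the weights of its left
  extensions. Let \<open>X = {w, w\<inverse>}\<close>. Growing words to the left until an element of \<open>X\<close> appears
  distributes the weight \<open>card A - c\<close> of the empty word over the words avoiding \<open>X\<close> and the
  words \<open>p\<close> whose only factor in \<open>X\<close> is a prefix. Growing the words \<open>p\<close> to the right gives a
  forest with roots \<open>X\<close> whose leaves are the complete return words, so the number of leaves
  is \<open>card X\<close> plus the total weight of the words \<open>p\<close>. Nonnegativity of the weights bounds the number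
  of leaves; recurrence then makes the forest finite and leaves no long word avoiding \<open>X\<close>, whence
  there are \<open>card A - c + card X\<close> complete return words, and here \<open>c = card X = 2\<close>. Finally, erasing is injective
  on them.
\<close>

subsection \<open>Counting the edges of a tree\<close>

definition edge_rel :: "'v set set \<Rightarrow> ('v \<times> 'v) set" where
  "edge_rel E = {(x, y). {x, y} \<in> E}"

text \<open>No vertex set occurs, so the property passes to subsets of \<open>E\<close> when a leaf
  is deleted. In a simple graph the vertices of such a cycle lie in \<open>V\<close>
  automatically.\<close>

definition acyclic_edges :: "'v set set \<Rightarrow> bool" where
  "acyclic_edges E \<longleftrightarrow>
     \<not> (\<exists>p. successively (\<lambda>x y. {x, y} \<in> E) p \<and> distinct p \<and> 3 \<le> length p \<and> {last p, hd p} \<in> E)"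

lemma successively_rtrancl:
  assumes "successively (\<lambda>x y. {x, y} \<in> E) p" "p \<noteq> []"
  shows "(hd p, last p) \<in> (edge_rel E)\<^sup>*"
  using assms
proof (induction p rule: induct_list012)
  case (3 x y zs)
  then have "(x, y) \<in> edge_rel E" "(y, last (y # zs)) \<in> (edge_rel E)\<^sup>*"
    by (auto simp: edge_rel_def)
  then show ?case by (simp add: converse_rtrancl_into_rtrancl)
qed auto

lemma successively_edges_subset:
  assumes "simple_graph V E" "successively (\<lambda>x y. {x, y} \<in> E) p" "2 \<le> length p"
  shows "set p \<subseteq> V"
  using assms(2,3)
proof (induction p rule: induct_list012)
  case (3 x y zs)
  have "{x, y} \<subseteq> V" using 3 assms(1) by (auto simp: simple_graph_def)
  then show ?case using 3 by (cases zs) auto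
qed auto

lemma tree_graph_rtrancl:
  assumes "tree_graph V E"
  shows "V \<noteq> {}" "\<forall>x\<in>V. \<forall>y\<in>V. (x, y) \<in> (edge_rel E)\<^sup>*" "acyclic_edges E"
proof -
  show "V \<noteq> {}" using assms by (auto simp: tree_graph_def graph_connected_def)
  show "\<forall>x\<in>V. \<forall>y\<in>V. (x, y) \<in> (edge_rel E)\<^sup>*"
  proof (intro ballI)
    fix x y assume "x \<in> V" "y \<in> V"
    then obtain p where "graph_walk V E p" "hd p = x" "last p = y"
      using assms unfolding tree_graph_def graph_connected_def by metis
    then show "(x, y) \<in> (edge_rel E)\<^sup>*"
      using successively_rtrancl[of E p] by (auto simp: graph_walk_def)
  qed
  have sg: "simple_graph V E" using assms by (simp add: tree_graph_def)
  have "graph_cycle V E p" if "successively (\<lambda>x y. {x, y} \<in> E) p" "distinct p" "3 \<le> length p"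
    "{last p, hd p} \<in> E" for p
    using that successively_edges_subset[OF sg that(1)]
    by (auto simp: graph_cycle_def graph_walk_def)
  then show "acyclic_edges E"
    using assms unfolding tree_graph_def acyclic_edges_def by blast
qed

lemma acyclic_edges_subset: "acyclic_edges E \<Longrightarrow> E' \<subseteq> E \<Longrightarrow> acyclic_edges E'"
  unfolding acyclic_edges_def by (meson subsetD successively_mono)

text \<open>The first vertex of a longest path is a leaf.\<close>
lemma exists_leaf:
  assumes "finite V" "simple_graph V E" "acyclic_edges E" "E \<noteq> {}"
  obtains v u where "v \<in> V" "u \<in> V" "v \<noteq> u" "{v, u} \<in> E" "\<And>e. e \<in> E \<Longrightarrow> v \<in> e \<Longrightarrow> e = {v, u}"
proof -
  define W where "W = {p. successively (\<lambda>x y. {x, y} \<in> E) p \<and> distinct p \<and> 2 \<le> length p}"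
  have edge: "x \<noteq> y \<and> x \<in> V \<and> y \<in> V" if "{x, y} \<in> E" for x y
  proof -
    have "card {x, y} = 2" "{x, y} \<subseteq> V" using that assms(2) by (auto simp: simple_graph_def)
    then show ?thesis by (cases "x = y") auto
  qed
  have two: "\<exists>x y. e = {x, y}" if "e \<in> E" for e
    using that assms(2) unfolding simple_graph_def card_2_iff by metis
  have len: "length p < Suc (card V)" if "p \<in> W" for p
  proof -
    have "set p \<subseteq> V" using that successively_edges_subset[OF assms(2)] by (auto simp: W_def)
    then have "card (set p) \<le> card V" using assms(1) by (simp add: card_mono)
    then show ?thesis using that by (simp add: W_def distinct_card)
  qed
  obtain e where "e \<in> E" using assms(4) by blast
  then obtain x y where "{x, y} \<in> E" using two by blast
  then have "[x, y] \<in> W" using edge by (auto simp: W_def)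
  then obtain p where p: "p \<in> W" "\<And>q. q \<in> W \<Longrightarrow> length q \<le> length p"
    using ex_has_greatest_nat[of "\<lambda>p. p \<in> W" _ length "Suc (card V)"] len by (meson less_imp_le)
  then obtain v u r where vu: "p = v # u # r"
    by (cases p rule: remdups_adj.cases) (auto simp: W_def)
  have e: "{v, u} \<in> E" using p(1) by (auto simp: W_def vu)
  \<comment> \<open>A second neighbour \<open>y\<close> of \<open>v\<close> either prolongs the
    longest path \<open>p\<close> at its front, or lies on \<open>p\<close> beyond \<open>u\<close>
    and closes a cycle through \<open>v\<close> and \<open>u\<close>.\<close>
  have "y = u" if "{v, y} \<in> E" for y
  proof (rule ccontr)
    assume ne: "y \<noteq> u"
    have "y # p \<notin> W" using p(2)[of "y # p"] by auto
    then have "y \<in> set p" using p(1) that by (auto simp: W_def vu insert_commute)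
    then have "y \<in> set r" using ne edge[OF that] by (auto simp: vu)
    then obtain r1 r2 where r: "r = r1 @ y # r2" by (meson split_list)
    let ?q = "v # u # r1 @ [y]"
    have "successively (\<lambda>x y. {x, y} \<in> E) ?q"
      using p(1) successively_append_iff[of "\<lambda>x y. {x, y} \<in> E" ?q r2]
      by (simp add: W_def vu r)
    moreover have "distinct ?q" using p(1) by (auto simp: W_def vu r)
    moreover have "3 \<le> length ?q" by simp
    moreover have "{last ?q, hd ?q} \<in> E" using that by (simp add: insert_commute)
    ultimately show False using assms(3) unfolding acyclic_edges_def by blast
  qed
  then have "e = {v, u}" if "e \<in> E" "v \<in> e" for e
  proof -
    obtain x y where "e = {x, y}" using two \<open>e \<in> E\<close> by blast
    then have "e = {v, x} \<or> e = {v, y}" using \<open>v \<in> e\<close> by auto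
    then show ?thesis using \<open>\<And>y. {v, y} \<in> E \<Longrightarrow> y = u\<close> \<open>e \<in> E\<close> by blast
  qed
  then show thesis using that[of v u] e edge[OF e] by blast
qed

text \<open>Induction on the number of vertices: deleting a leaf removes one vertex and one edge and
  keeps the graph connected and acyclic.\<close>

lemma card_edges_connected_acyclic:
  assumes "finite V" "V \<noteq> {}" "simple_graph V E" "acyclic_edges E"
    "\<forall>x\<in>V. \<forall>y\<in>V. (x, y) \<in> (edge_rel E)\<^sup>*"
  shows "card E + 1 = card V"
  using assms
proof (induction "card V" arbitrary: V E rule: less_induct)
  case less
  note fin = \<open>finite V\<close>
  show ?case
  proof (cases "E = {}")
    case True
    then have "edge_rel E = {}" by (simp add: edge_rel_def)
    then have "\<forall>x\<in>V. \<forall>y\<in>V. x = y" using less.prems(5) by simp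
    then obtain x where "V = {x}" using less.prems(2) by blast
    then show ?thesis using True by simp
  next
    case False
    from exists_leaf[OF less.prems(1,3,4) False]
    obtain v u where vu: "v \<in> V" "u \<in> V" "v \<noteq> u" "{v, u} \<in> E"
      and leaf: "\<And>e. e \<in> E \<Longrightarrow> v \<in> e \<Longrightarrow> e = {v, u}" by metis
    define V' E' where "V' = V - {v}" and "E' = E - {{v, u}}"
    \<comment> \<open>\<open>f\<close> retracts the leaf onto its neighbour. The deleted edge
      collapses to a point and every other edge is fixed, so paths of \<open>E\<close> become paths
      of \<open>E'\<close>.\<close>
    define f where "f x = (if x = v then u else x)" for x
    have finE: "finite E"
      using less.prems(1,3) by (auto simp: simple_graph_def intro!: finite_subset[of E "Pow V"])
    have conn: "(f x, f y) \<in> (edge_rel E')\<^sup>*" if "(x, y) \<in> (edge_rel E)\<^sup>*" for x y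
      using that
    proof (induction rule: rtrancl_induct)
      case (step y z)
      have yz: "{y, z} \<in> E" using step.hyps by (simp add: edge_rel_def)
      have "(f y, f z) \<in> (edge_rel E')\<^sup>*"
      proof (cases "{y, z} = {v, u}")
        case True
        then show ?thesis by (auto simp: f_def doubleton_eq_iff)
      next
        case False
        then have "v \<noteq> y" "v \<noteq> z" "{y, z} \<in> E'" using leaf[OF yz] yz by (auto simp: E'_def)
        then show ?thesis by (auto simp: f_def edge_rel_def)
      qed
      then show ?case using step.IH by simp
    qed simp
    have "card E' + 1 = card V'"
    proof (rule less.hyps)
      show "card V' < card V" unfolding V'_def using fin vu(1) by (rule card_Diff1_less)
      show "finite V'" "V' \<noteq> {}" using fin vu by (auto simp: V'_def)
      have "v \<notin> e" if "e \<in> E'" for e using leaf[of e] that by (auto simp: E'_def)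
      then show "simple_graph V' E'"
        using less.prems(3) by (auto simp: simple_graph_def V'_def E'_def)
      show "acyclic_edges E'" using acyclic_edges_subset[OF less.prems(4)] by (auto simp: E'_def)
      show "\<forall>x\<in>V'. \<forall>y\<in>V'. (x, y) \<in> (edge_rel E')\<^sup>*"
      proof (intro ballI)
        fix x y assume "x \<in> V'" "y \<in> V'"
        then show "(x, y) \<in> (edge_rel E')\<^sup>*"
          using conn[of x y] less.prems(5) by (auto simp: V'_def f_def)
      qed
    qed
    moreover have "card V = Suc (card V')" unfolding V'_def by (rule card.remove[OF fin vu(1)])
    moreover have "card E = Suc (card E')" unfolding E'_def by (rule card.remove[OF finE vu(4)])
    ultimately show ?thesis by simp
  qed
qed

lemma card_edges_tree:
  assumes "tree_graph V E" "finite V"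
  shows "card E + 1 = card V"
  using card_edges_connected_acyclic[OF assms(2)] tree_graph_rtrancl[OF assms(1)] assms(1)
  by (simp add: tree_graph_def)

lemma card_edges_disjoint_union_of_trees:
  assumes "disjoint_union_of_trees c V E" "finite V"
  shows "card E + c = card V"
proof -
  obtain VT ET where t: "\<And>i. i < c \<Longrightarrow> tree_graph (VT i) (ET i)"
    and d: "disjoint_family_on VT {..<c}"
    and V: "V = (\<Union>i<c. VT i)" and E: "E = (\<Union>i<c. ET i)"
    using assms(1) unfolding disjoint_union_of_trees_def by blast
  have finV: "finite (VT i)" if "i < c" for i
    using assms(2) that by (simp add: V)
  have sub: "e \<subseteq> VT i" "e \<noteq> {}" if "i < c" "e \<in> ET i" for i e
    using t[OF that(1)] that(2) by (auto simp: tree_graph_def simple_graph_def)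
  have finE: "finite (ET i)" if "i < c" for i
    using sub[OF that] finV[OF that] by (meson PowI finite_Pow_iff finite_subset subsetI)
  \<comment> \<open>Edges are nonempty subsets of the vertex set of their own tree, so disjointness
    passes from vertices to edges.\<close>
  have dE: "ET i \<inter> ET j = {}" if "i < c" "j < c" "i \<noteq> j" for i j
  proof -
    have "VT i \<inter> VT j = {}" using d that by (auto simp: disjoint_family_on_def)
    then show ?thesis using sub that by blast
  qed
  have "card V = (\<Sum>i<c. card (VT i))"
    unfolding V using finV d by (intro card_UN_disjoint) (auto simp: disjoint_family_on_def)
  also have "\<dots> = (\<Sum>i<c. card (ET i) + 1)"
    using card_edges_tree[OF t finV] by (intro sum.cong) auto
  also have "\<dots> = card E + c"
    unfolding E using finE dE by (subst card_UN_disjoint) (auto simp: sum.distrib simp del: add_Suc_right)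
  finally show ?thesis by simp
qed

subsection \<open>The weight of a word\<close>

lemma card_ext_graph_edges: "card (ext_graph_edges A S w) = card (bi_ext A S w)"
proof -
  have "ext_graph_edges A S w = (\<lambda>(a, b). {Inl a, Inr b}) ` bi_ext A S w"
    by (auto simp: ext_graph_edges_def)
  then show ?thesis
    by (auto simp: inj_on_def doubleton_eq_iff intro!: card_image)
qed

lemma tree_set_card_bi_ext:
  assumes "finite A" "tree_set A c S" "w \<in> S"
  shows "card (bi_ext A S w) + (if w = [] then c else 1)
    = card (left_ext A S w) + card (right_ext A S w)"
proof -
  have fin: "finite (left_ext A S w)" "finite (right_ext A S w)"
    using assms(1) by (auto simp: left_ext_def right_ext_def)
  then have fV: "finite (ext_graph_verts A S w)"
    and "card (ext_graph_verts A S w) = card (left_ext A S w) + card (right_ext A S w)"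
    by (simp_all add: ext_graph_verts_def card_Plus)
  moreover have "card (ext_graph_edges A S w) + (if w = [] then c else 1)
      = card (ext_graph_verts A S w)"
    using card_edges_disjoint_union_of_trees[OF _ fV] card_edges_tree[OF _ fV] assms(2,3)
    by (simp add: tree_set_def)
  ultimately show ?thesis by (simp only: card_ext_graph_edges)
qed

definition ext_weight :: "'a set \<Rightarrow> nat \<Rightarrow> 'a list set \<Rightarrow> 'a list \<Rightarrow> int" where
  "ext_weight A c S u = int (card (right_ext A S u)) - (if u = [] then int c else 1)"

lemma factorial_setD: "factorial_set A S \<Longrightarrow> u \<in> S \<Longrightarrow> sublist v u \<Longrightarrow> v \<in> S"
  by (auto simp: factorial_set_def)

lemma tree_set_factorial: "tree_set A c S \<Longrightarrow> factorial_set A S"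
  by (simp add: tree_set_def biextendable_set_def)

text \<open>Sort the pairs of \<open>bi_ext A S u\<close> by first letter. Each \<open>a # u\<close>
  is nonempty and loses 1, so the sum is the number of edges of the extension graph minus the number
  of left vertices; the edge count of the trees turns this into the weight of
  \<open>u\<close>.\<close>

lemma sum_ext_weight_left_ext:
  assumes "finite A" "tree_set A c S" "u \<in> S"
  shows "(\<Sum>a\<in>left_ext A S u. ext_weight A c S (a # u)) = ext_weight A c S u"
proof -
  have "a # u \<in> S" if "a # u @ [b] \<in> S" for a b
    by (rule factorial_setD[OF tree_set_factorial[OF assms(2)] that]) (metis append_Cons prefix_imp_sublist prefixI)
  \<comment> \<open>Factoriality makes the first letter of each pair a left extension of
    \<open>u\<close>.\<close>
  then have "bi_ext A S u = Sigma (left_ext A S u) (\<lambda>a. right_ext A S (a # u))"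
    by (auto simp: bi_ext_def left_ext_def right_ext_def)
  then have "card (bi_ext A S u) = (\<Sum>a\<in>left_ext A S u. card (right_ext A S (a # u)))"
    using assms(1) by (simp add: left_ext_def right_ext_def)
  then have "(\<Sum>a\<in>left_ext A S u. ext_weight A c S (a # u))
      = int (card (bi_ext A S u)) - int (card (left_ext A S u))"
    by (simp add: ext_weight_def sum_subtractf)
  also have "\<dots> = ext_weight A c S u"
    using tree_set_card_bi_ext[OF assms] by (auto simp: ext_weight_def)
  finally show ?thesis .
qed

lemma ext_weight_nonneg:
  assumes "finite A" "tree_set A c S" "u \<in> S" "u \<noteq> []"
  shows "ext_weight A c S u \<ge> 0"
proof -
  obtain a b where "a # u @ [b] \<in> S" "b \<in> A"
    using assms(2,3) by (auto simp: tree_set_def biextendable_set_def bi_ext_def)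
  then have "b \<in> right_ext A S u"
    using factorial_setD[OF tree_set_factorial[OF assms(2)], of "a # u @ [b]" "u @ [b]"]
    by (simp add: right_ext_def sublist_Cons_right)
  then have "card (right_ext A S u) \<noteq> 0"
    using assms(1) by (auto simp: right_ext_def)
  then show ?thesis using assms(4) by (simp add: ext_weight_def)
qed

subsection \<open>Complete return words\<close>

definition avoids :: "'a list set \<Rightarrow> 'a list \<Rightarrow> bool" where
  "avoids X u \<longleftrightarrow> (\<forall>x\<in>X. \<not> sublist x u)"

lemma avoids_sublist: "avoids X u \<Longrightarrow> sublist v u \<Longrightarrow> avoids X v"
  unfolding avoids_def by (meson sublist_order.order_trans)

lemma avoids_Cons: "avoids X (a # u) \<longleftrightarrow> avoids X u \<and> (\<forall>x\<in>X. \<not> prefix x (a # u))"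
  by (auto simp: avoids_def sublist_Cons_right)

lemma avoids_snoc: "avoids X (u @ [b]) \<longleftrightarrow> avoids X u \<and> (\<forall>x\<in>X. \<not> suffix x (u @ [b]))"
  by (auto simp: avoids_def sublist_snoc)

lemma internal_factor_Cons_snoc: "internal_factor x (a # q @ [b]) \<longleftrightarrow> sublist x q"
proof
  assume "internal_factor x (a # q @ [b])"
  then obtain u w where "u \<noteq> []" "w \<noteq> []" and eq: "a # q @ [b] = u @ x @ w"
    by (auto simp: internal_factor_def)
  then obtain u1 w1 z where "u = a # u1" "w = w1 @ [z]"
    by (metis append_eq_Cons_conv rev_exhaust)
  with eq have "q = u1 @ x @ w1" by simp
  then show "sublist x q" by auto
next
  assume "sublist x q"
  then obtain u w where "q = u @ x @ w" by (auto simp: sublist_def)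
  then have "a # q @ [b] = (a # u) @ x @ (w @ [b])" by simp
  then show "internal_factor x (a # q @ [b])"
    unfolding internal_factor_def by blast
qed

text \<open>As \<open>tl p\<close> avoids \<open>X\<close>, an element of \<open>X\<close> in
  \<open>p\<close> must be a prefix, and one in \<open>tl (p @ [b])\<close> must be a suffix.
  Complete return words thus become the leaves reached when \<open>p\<close> grows by one
  letter.\<close>

lemma complete_return_words_snoc:
  assumes "p \<noteq> []"
  shows "p @ [b] \<in> complete_return_words S X \<longleftrightarrow>
    p @ [b] \<in> S \<and> avoids X (tl p) \<and> \<not> avoids X p \<and> \<not> avoids X (tl (p @ [b]))"
proof -
  obtain a q where p: "p = a # q" using assms by (cases p) auto
  have 1: "strict_prefix x (a # q @ [b]) \<longleftrightarrow> prefix x (a # q)" for x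
    unfolding strict_prefix_def using prefix_snoc[of x "a # q" b]
    by (auto simp del: prefix_snoc dest: prefix_length_le)
  have 2: "strict_suffix x (a # q @ [b]) \<longleftrightarrow> suffix x (q @ [b])" for x
    unfolding strict_suffix_def suffix_Cons[of x a "q @ [b]"]
    by (metis Cons_eq_appendI length_Cons lessI linorder_not_less suffix_length_le)
  show ?thesis
    using avoids_Cons[of X a q] avoids_snoc[of X q b]
    by (auto simp: p complete_return_words_def 1 2 internal_factor_Cons_snoc avoids_def)
qed

lemma complete_return_words_length:
  assumes "u \<in> complete_return_words S X" "\<forall>x\<in>X. length x = m"
  shows "length u > m"
  using assms by (auto simp: complete_return_words_def dest: prefix_length_less)

text \<open>Any characteristic and any set \<open>X\<close> of words of a common length are allowed.
  The common length makes all roots of the forest lie at level \<open>m\<close>.\<close>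

locale tree_return_words =
  fixes A :: "'a set" and c :: nat and S X :: "'a list set" and m :: nat
  assumes fin: "finite A"
    and tree: "tree_set A c S"
    and recurrent: "recurrent_set A S"
    and X_sub: "X \<subseteq> S"
    and X_nonempty: "X \<noteq> {}"
    and X_length: "\<forall>x\<in>X. length x = m"
    and m_pos: "m > 0"
begin

lemma sublist_in_S: "u \<in> S \<Longrightarrow> sublist v u \<Longrightarrow> v \<in> S"
  using factorial_setD[OF tree_set_factorial[OF tree]] by blast

lemma S_lists: "u \<in> S \<Longrightarrow> set u \<subseteq> A"
  using tree_set_factorial[OF tree] by (auto simp: factorial_set_def)

section \<open>Conservation of weight, level by level\<close>

definition avoiding :: "nat \<Rightarrow> 'a list set" where
  "avoiding n = {u \<in> S. length u = n \<and> avoids X u}"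

text \<open>The inner nodes of the forest at level \<open>n\<close>: every occurrence of an element
  of \<open>X\<close> starts at the first letter.\<close>

definition rooted :: "nat \<Rightarrow> 'a list set" where
  "rooted n = {p \<in> S. length p = n \<and> avoids X (tl p) \<and> \<not> avoids X p}"

definition returns :: "nat \<Rightarrow> 'a list set" where
  "returns n = {u \<in> complete_return_words S X. length u = n}"

definition returns_upto :: "nat \<Rightarrow> 'a list set" where
  "returns_upto n = {u \<in> complete_return_words S X. length u \<le> n}"

lemma finite_levels: "finite (avoiding n)" "finite (rooted n)" "finite (returns n)"
  "finite (returns_upto n)"
proof -
  have "finite {u. set u \<subseteq> A \<and> length u \<le> n}"
    using fin by (rule finite_lists_length_le)
  then show "finite (avoiding n)" "finite (rooted n)" "finite (returns n)" "finite (returns_upto n)"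
    using S_lists
    by (auto simp: avoiding_def rooted_def returns_def returns_upto_def complete_return_words_def
        elim!: finite_subset[rotated])
qed

lemma avoids_Nil: "avoids X []"
  using X_length m_pos by (auto simp: avoids_def)

text \<open>Words of both kinds at level \<open>Suc n\<close> have a tail avoiding \<open>X\<close>,
  so each arises exactly once as a left extension of a word in \<open>avoiding n\<close>; the weight
  is conserved by \<open>sum_ext_weight_left_ext\<close>.\<close>

lemma sum_weight_avoiding:
  "(\<Sum>u\<in>avoiding n. ext_weight A c S u)
    = (\<Sum>u\<in>avoiding (Suc n). ext_weight A c S u) + (\<Sum>u\<in>rooted (Suc n). ext_weight A c S u)"
proof -
  let ?f = "\<lambda>(u, a). a # u"
  have img: "avoiding (Suc n) \<union> rooted (Suc n) = ?f ` Sigma (avoiding n) (left_ext A S)"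
  proof (intro equalityI subsetI)
    fix p assume p: "p \<in> avoiding (Suc n) \<union> rooted (Suc n)"
    then obtain a u where au: "p = a # u" "length u = n" "a # u \<in> S"
      by (auto simp: avoiding_def rooted_def length_Suc_conv)
    then have "u \<in> S" "a \<in> A" using sublist_in_S[of p u] S_lists[of p] by (auto simp: sublist_Cons_right)
    then have "(u, a) \<in> Sigma (avoiding n) (left_ext A S)"
      using p au by (auto simp: avoiding_def rooted_def left_ext_def avoids_Cons)
    then show "p \<in> ?f ` Sigma (avoiding n) (left_ext A S)" using au(1) by force
  qed (auto simp: avoiding_def rooted_def left_ext_def)
  have "(\<Sum>u\<in>avoiding n. ext_weight A c S u)
      = (\<Sum>u\<in>avoiding n. \<Sum>a\<in>left_ext A S u. ext_weight A c S (a # u))"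
    using sum_ext_weight_left_ext[OF fin tree] by (intro sum.cong) (auto simp: avoiding_def)
  also have "\<dots> = (\<Sum>(u, a)\<in>Sigma (avoiding n) (left_ext A S). ext_weight A c S (a # u))"
    using fin finite_levels by (intro sum.Sigma) (auto simp: left_ext_def)
  also have "\<dots> = sum (ext_weight A c S) (?f ` Sigma (avoiding n) (left_ext A S))"
    by (subst sum.reindex) (auto simp: inj_on_def case_prod_unfold)
  also have "\<dots> = sum (ext_weight A c S) (avoiding (Suc n) \<union> rooted (Suc n))"
    by (simp only: img)
  also have "\<dots> = sum (ext_weight A c S) (avoiding (Suc n)) + sum (ext_weight A c S) (rooted (Suc n))"
    using finite_levels by (intro sum.union_disjoint) (auto simp: avoiding_def rooted_def)
  finally show ?thesis .
qed

text \<open>A right extension of a rooted word stays rooted if its tail still avoids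
  \<open>X\<close>, and is a complete return word otherwise.\<close>

lemma sum_right_ext_rooted:
  assumes "n \<ge> m"
  shows "(\<Sum>p\<in>rooted n. card (right_ext A S p)) = card (rooted (Suc n)) + card (returns (Suc n))"
proof -
  let ?f = "\<lambda>(p, b). p @ [b]"
  have tl_snoc: "tl (p @ [b]) = tl p @ [b]" if "length p = n" for p :: "'a list" and b
    using that assms m_pos by (cases p) auto
  have img: "rooted (Suc n) \<union> returns (Suc n) = ?f ` Sigma (rooted n) (right_ext A S)"
  proof (intro equalityI subsetI)
    fix u assume u: "u \<in> rooted (Suc n) \<union> returns (Suc n)"
    then obtain p b where pb: "u = p @ [b]" "length p = n" "p @ [b] \<in> S"
      by (cases u rule: rev_cases)
         (auto simp: rooted_def returns_def complete_return_words_def)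
    then have "p \<in> S" "b \<in> A" "p \<noteq> []"
      using sublist_in_S[of u p] S_lists[of u] assms m_pos by auto
    have "avoids X (tl p)" "\<not> avoids X p"
    proof -
      consider "u \<in> rooted (Suc n)" | "u \<in> returns (Suc n)" using u by blast
      then have "avoids X (tl p) \<and> \<not> avoids X p"
      proof cases
        case 1
        then have av: "avoids X (tl p @ [b])" "\<not> avoids X (p @ [b])"
          using tl_snoc[OF pb(2)] pb(1) by (auto simp: rooted_def)
        obtain a q where q: "p = a # q" using \<open>p \<noteq> []\<close> by (cases p) auto
        then obtain x where x: "x \<in> X" "prefix x (p @ [b])"
          using av avoids_Cons[of X a "q @ [b]"] by auto
        \<comment> \<open>As \<open>length x = m\<close> is at most \<open>n = length p\<close>, the
          prefix \<open>x\<close> does not reach the last letter \<open>b\<close>.\<close>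
        then have "prefix x p"
          using X_length assms pb(2) by (auto dest: prefix_length_le)
        then have "\<not> avoids X p" using x(1) by (auto simp: avoids_def)
        then show ?thesis using av(1) by (auto simp: avoids_snoc)
      next
        case 2
        then show ?thesis
          using complete_return_words_snoc[OF \<open>p \<noteq> []\<close>] pb(1) by (auto simp: returns_def)
      qed
      then show "avoids X (tl p)" "\<not> avoids X p" by auto
    qed
    then have "(p, b) \<in> Sigma (rooted n) (right_ext A S)"
      using pb \<open>p \<in> S\<close> \<open>b \<in> A\<close> by (auto simp: rooted_def right_ext_def)
    then show "u \<in> ?f ` Sigma (rooted n) (right_ext A S)" using pb(1) by force
  next
    fix u assume "u \<in> ?f ` Sigma (rooted n) (right_ext A S)"
    then obtain p b where p: "u = p @ [b]" "p \<in> rooted n" "p @ [b] \<in> S"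
      by (auto simp: right_ext_def)
    then have "p \<noteq> []" using avoids_Nil by (auto simp: rooted_def)
    then show "u \<in> rooted (Suc n) \<union> returns (Suc n)"
      using p complete_return_words_snoc[of p b S X]
      by (auto simp: rooted_def returns_def avoids_snoc)
  qed
  have "rooted (Suc n) \<inter> returns (Suc n) = {}"
  proof -
    have False if "u \<in> rooted (Suc n)" "u \<in> returns (Suc n)" for u
    proof (cases u rule: rev_cases)
      case (snoc p b)
      then have "p \<noteq> []" using that(1) assms m_pos by (auto simp: rooted_def)
      then show False
        using that complete_return_words_snoc[of p b S X] snoc
        by (auto simp: rooted_def returns_def)
    qed (use that in \<open>simp add: rooted_def\<close>)
    then show ?thesis by blast
  qed
  then have "card (rooted (Suc n)) + card (returns (Suc n))
      = card (rooted (Suc n) \<union> returns (Suc n))"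
    using finite_levels by (simp add: card_Un_disjoint)
  also have "\<dots> = card (Sigma (rooted n) (right_ext A S))"
    unfolding img by (rule card_image) (auto simp: inj_on_def)
  also have "\<dots> = (\<Sum>p\<in>rooted n. card (right_ext A S p))"
    using fin finite_levels by (simp add: right_ext_def)
  finally show ?thesis by simp
qed

lemma card_returns_upto_Suc: "card (returns_upto (Suc n)) = card (returns_upto n) + card (returns (Suc n))"
proof -
  have "returns_upto (Suc n) = returns_upto n \<union> returns (Suc n)" "returns_upto n \<inter> returns (Suc n) = {}"
    by (auto simp: returns_upto_def returns_def)
  then show ?thesis using finite_levels by (simp add: card_Un_disjoint)
qed

lemma rooted_m: "rooted m = X"
proof (intro equalityI subsetI)
  fix p assume p: "p \<in> rooted m"
  then obtain x where x: "x \<in> X" "sublist x p" by (auto simp: rooted_def avoids_def)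
  then have "length x = length p" using p X_length by (simp add: rooted_def)
  then show "p \<in> X" using x by (auto simp: sublist_def)
next
  fix p assume p: "p \<in> X"
  then have "length (tl p) < m" using X_length m_pos by simp
  then have "avoids X (tl p)"
    unfolding avoids_def using X_length by (metis leD sublist_length_le)
  then show "p \<in> rooted m"
    using p X_sub X_length by (auto simp: rooted_def avoids_def)
qed

lemma rooted_below: "n < m \<Longrightarrow> rooted n = {}"
  using X_length by (auto simp: rooted_def avoids_def dest: sublist_length_le)

lemma returns_upto_m: "returns_upto m = {}"
  using complete_return_words_length X_length by (fastforce simp: returns_upto_def)

text \<open>Below level \<open>m\<close> no word is rooted, so the weight of the empty word is
  passed on without loss.\<close>

lemma sum_weight_avoiding_below:
  "n < m \<Longrightarrow> (\<Sum>u\<in>avoiding n. ext_weight A c S u) = int (card A) - int c"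
proof (induction n)
  case 0
  obtain x where "x \<in> S" using X_sub X_nonempty by blast
  then have "[] \<in> S" using sublist_in_S by auto
  then have "avoiding 0 = {[]}" using avoids_Nil by (auto simp: avoiding_def)
  moreover have "right_ext A S [] = A"
    using tree_set_factorial[OF tree] by (auto simp: right_ext_def factorial_set_def)
  ultimately show ?case by (simp add: ext_weight_def)
next
  case (Suc n)
  then show ?case using sum_weight_avoiding[of n] rooted_below[of "Suc n"] by simp
qed

text \<open>Passing from \<open>n\<close> to \<open>Suc n\<close>, the avoiding words give up the
  weight of \<open>rooted n\<close>, which is exactly the growth of the forest in nodes and leaves.
  This weight is spent only in that step, hence the index \<open>n - 1\<close> in the first
  sum.\<close>

lemma level_invariant:
  assumes "n \<ge> m"
  shows "(\<Sum>u\<in>avoiding (n - 1). ext_weight A c S u) + int (card (rooted n)) + int (card (returns_upto n))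
    = int (card A) - int c + int (card X)"
  using assms
proof (induction n rule: dec_induct)
  case base
  then show ?case
    using sum_weight_avoiding_below[of "m - 1"] m_pos by (simp add: rooted_m returns_upto_m)
next
  case (step n)
  have "(\<Sum>u\<in>rooted n. ext_weight A c S u)
      = (\<Sum>u\<in>rooted n. int (card (right_ext A S u)) - 1)"
    using avoids_Nil by (intro sum.cong) (auto simp: ext_weight_def rooted_def)
  also have "\<dots> = int (\<Sum>p\<in>rooted n. card (right_ext A S p)) - int (card (rooted n))"
    by (simp add: sum_subtractf)
  finally show ?case
    using step sum_weight_avoiding[of "n - 1"] sum_right_ext_rooted[of n] m_pos
      card_returns_upto_Suc[of n] by simp
qed

section \<open>Finiteness and the exact count\<close>

lemma card_returns_upto_le:
  "int (card (returns_upto n)) \<le> int (card A) - int c + int (card X)"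
proof -
  \<comment> \<open>\<open>k > m\<close> makes the words of length \<open>k - 1\<close> nonempty, so
    that their weights are nonnegative.\<close>
  obtain k where k: "k \<ge> n" "k > m" using that[of "max n (Suc m)"] by simp
  have "(\<Sum>u\<in>avoiding (k - 1). ext_weight A c S u) \<ge> 0"
    using k m_pos by (intro sum_nonneg ext_weight_nonneg[OF fin tree]) (auto simp: avoiding_def)
  moreover have "card (returns_upto n) \<le> card (returns_upto k)"
    using k(1) finite_levels by (intro card_mono) (auto simp: returns_upto_def)
  ultimately show ?thesis using level_invariant[of k] k(2) by linarith
qed

lemma finite_complete_return_words: "finite (complete_return_words S X)"
proof (rule ccontr)
  assume "infinite (complete_return_words S X)"
  then obtain F where F: "F \<subseteq> complete_return_words S X" "finite F"
      "card F = Suc (nat (int (card A) - int c + int (card X)))"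
    using infinite_arbitrarily_large by blast
  then have "F \<subseteq> returns_upto (Max (length ` F))"
    by (auto simp: returns_upto_def)
  then have "card F \<le> card (returns_upto (Max (length ` F)))"
    using finite_levels by (simp add: card_mono)
  then show False using card_returns_upto_le[of "Max (length ` F)"] F(3) by linarith
qed

text \<open>Follow the branch spelled by \<open>y\<close>: the first letter after which the tail
  meets \<open>X\<close> completes a return word.\<close>

lemma rooted_extends_to_return:
  assumes "p @ y \<in> S" "avoids X (tl p)" "\<not> avoids X p" "\<not> avoids X (tl (p @ y))"
  shows "\<exists>u\<in>complete_return_words S X. length u > length p"
  using assms
proof (induction y arbitrary: p)
  case (Cons b y)
  have S: "p @ [b] \<in> S" using sublist_in_S[OF Cons.prems(1)] by (simp add: prefix_imp_sublist)
  have ne: "p \<noteq> []" using Cons.prems(3) avoids_Nil by auto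
  show ?case
  proof (cases "avoids X (tl (p @ [b]))")
    case True
    then have "\<exists>u\<in>complete_return_words S X. length u > length (p @ [b])"
      using Cons.prems by (intro Cons.IH) (auto simp: avoids_snoc)
    then show ?thesis by (auto intro: Suc_lessD)
  next
    case False
    then have "p @ [b] \<in> complete_return_words S X"
      using Cons.prems S complete_return_words_snoc[OF ne] by blast
    then show ?thesis by (rule bexI[rotated]) simp
  qed
qed simp

text \<open>Extend \<open>u\<close> to the left along \<open>z\<close>: when an element of
  \<open>X\<close> first appears, it is a prefix and the tail still avoids \<open>X\<close>.\<close>

lemma avoiding_extends_to_rooted:
  assumes "z @ u \<in> S" "\<not> avoids X (z @ u)" "avoids X u"
  shows "\<exists>n > length u. rooted n \<noteq> {}"
  using assms
proof (induction z)
  case (Cons a z)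
  show ?case
  proof (cases "avoids X (z @ u)")
    case True
    then have "a # z @ u \<in> rooted (Suc (length (z @ u)))"
      using Cons.prems by (auto simp: rooted_def)
    then show ?thesis by (metis empty_iff length_append less_Suc_eq_le le_add2)
  next
    case False
    then show ?thesis using Cons sublist_in_S[of "a # z @ u" "z @ u"] by (simp add: sublist_Cons_right)
  qed
qed simp

theorem card_complete_return_words:
  "int (card (complete_return_words S X)) = int (card A) - int c + int (card X)"
proof -
  obtain x where x: "x \<in> X" "x \<in> S" using X_nonempty X_sub by blast
  \<comment> \<open>\<open>N\<close> exceeds \<open>m\<close> and the length of every complete
    return word.\<close>
  define N where "N = Suc (Max (insert m (length ` complete_return_words S X)))"
  have "m \<le> Max (insert m (length ` complete_return_words S X))"
    using finite_complete_return_words by (intro Max_ge) auto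
  then have mN: "m < N" by (simp add: N_def)
  have len: "length u < N" if "u \<in> complete_return_words S X" for u
    unfolding N_def using finite_complete_return_words that by (intro le_imp_less_Suc Max_ge) auto
  \<comment> \<open>Recurrence places \<open>x\<close> after a rooted \<open>p\<close>, so
    \<open>p\<close> would lead to a return word longer than \<open>N\<close>.\<close>
  have rooted_empty: "rooted n = {}" if "n \<ge> N" for n
  proof (rule ccontr)
    assume "rooted n \<noteq> {}"
    then obtain p where p: "p \<in> rooted n" by blast
    then have "p \<in> S" "p \<noteq> []" using avoids_Nil by (auto simp: rooted_def)
    then obtain v where "p @ v @ x \<in> S"
      using recurrent x(2) by (auto simp: recurrent_set_def)
    moreover have "\<not> avoids X (tl (p @ v @ x))"
      using x(1) \<open>p \<noteq> []\<close> by (auto simp: avoids_def intro: suffix_imp_sublist suffix_appendI)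
    ultimately have "\<exists>u\<in>complete_return_words S X. length u > length p"
      using p rooted_extends_to_return[of p "v @ x"] by (auto simp: rooted_def)
    then show False using len that p by (fastforce simp: rooted_def)
  qed
  \<comment> \<open>Recurrence places \<open>x\<close> before an avoiding \<open>u\<close>, which
    would give a rooted word longer than \<open>N\<close>.\<close>
  have "avoiding N = {}"
  proof (rule ccontr)
    assume "avoiding N \<noteq> {}"
    then obtain u where u: "u \<in> S" "avoids X u" "length u = N" by (auto simp: avoiding_def)
    then obtain v where "x @ v @ u \<in> S"
      using recurrent x(2) by (auto simp: recurrent_set_def)
    moreover have "\<not> avoids X (x @ v @ u)" using x(1) by (auto simp: avoids_def)
    ultimately show False
      using avoiding_extends_to_rooted[of "x @ v" u] u rooted_empty by auto
  qed
  moreover have "returns_upto (Suc N) = complete_return_words S X"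
    using len by (fastforce simp: returns_upto_def)
  \<comment> \<open>At level \<open>Suc N\<close> only the leaves remain in the invariant.\<close>
  ultimately show ?thesis
    using level_invariant[of "Suc N"] mN rooted_empty[of "Suc N"] by simp
qed

end

subsection \<open>Mixed return words\<close>

lemma suffix_same_length: "suffix x u \<Longrightarrow> suffix y u \<Longrightarrow> length x = length y \<Longrightarrow> x = y"
  by (metis suffix_length_suffix suffix_order.antisym le_refl)

text \<open>The four cases tell which ends were erased and keep what is known about the ends that
  were not; this is the data needed to recover \<open>u\<close> from \<open>n\<close>.\<close>

lemma mixed_erase_cases:
  assumes u: "u \<in> complete_return_words S {w, v}"
    and v: "v = word_inv \<theta> w" and "w \<noteq> []" and ov: "\<not> words_overlap w v"
  defines "n \<equiv> mixed_erase \<theta> w u"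
  shows "u = w @ n \<and> suffix w u \<and> n \<noteq> [] \<or> u = w @ n @ v \<or>
    u = n \<and> prefix v u \<and> suffix w u \<or> u = n @ v \<and> prefix v u \<and> n \<noteq> []"
proof -
  have len: "length v = length w" by (simp add: v word_inv_def)
  have "v \<noteq> w" using ov \<open>w \<noteq> []\<close> by (auto simp: words_overlap_def)
  have pre: "prefix w u \<or> prefix v u" and suf: "strict_suffix w u \<or> strict_suffix v u"
    using u by (auto simp: complete_return_words_def strict_prefix_def)
  have lu: "length u > length w"
    using complete_return_words_length[OF u] len by simp
  have not_suf: "\<not> suffix v u" if "suffix w u"
    using suffix_same_length[OF that _ len[symmetric]] \<open>v \<noteq> w\<close> by blast
  show ?thesis
  proof (cases "prefix w u")
    case True
    then obtain r where r: "u = w @ r" by (auto simp: prefix_def)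
    show ?thesis
    proof (cases "suffix v u")
      case sv: True
      \<comment> \<open>Otherwise \<open>v\<close> starts inside the prefix \<open>w\<close>, and
        the shared part \<open>s\<close> is an overlap.\<close>
      have "suffix v r"
      proof (rule ccontr)
        assume "\<not> suffix v r"
        then obtain s where s: "v = s @ r" "suffix s w"
          using sv unfolding r suffix_append by blast
        then have "s \<noteq> []" using \<open>\<not> suffix v r\<close> by (metis append_Nil suffix_order.refl)
        with s have "words_overlap w v" by (auto simp: words_overlap_def)
        then show False using ov by simp
      qed
      then obtain k where k: "r = k @ v" by (auto simp: suffix_def)
      then have "n = k" using sv True len by (simp add: n_def mixed_erase_def v[symmetric] r Let_def)
      then show ?thesis using r k by simp
    next
      case False
      then have "n = r" using True by (simp add: n_def mixed_erase_def v[symmetric] r)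
      moreover have "r \<noteq> []" using lu r by auto
      ultimately show ?thesis using r False suf by (auto simp: strict_suffix_def)
    qed
  next
    case False
    then have pv: "prefix v u" using pre by simp
    show ?thesis
    proof (cases "suffix v u")
      case True
      then obtain k where k: "u = k @ v" by (auto simp: suffix_def)
      then have "n = k" using True False len by (simp add: n_def mixed_erase_def v[symmetric])
      moreover have "k \<noteq> []" using lu k len by auto
      ultimately show ?thesis using k pv by simp
    next
      case F2: False
      then have "n = u" using False by (simp add: n_def mixed_erase_def v[symmetric])
      then show ?thesis using pv suf F2 by (auto simp: strict_suffix_def)
    qed
  qed
qed

lemma internal_factorI: "u \<noteq> [] \<Longrightarrow> z \<noteq> [] \<Longrightarrow> internal_factor x (u @ x @ z)"
  by (auto simp: internal_factor_def)

text \<open>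
  The erased word reveals which ends were erased: in every mismatch but one, \<open>w\<close> or its inverse \<open>v\<close>
  would be an internal factor of one of the two return words. The exception is a short word
  \<open>n\<close> with both \<open>w @ n\<close> and \<open>n @ v\<close> complete return words; there \<open>n\<close> is an overlap.
\<close>
lemma inj_on_mixed_erase:
  assumes v: "v = word_inv \<theta> w" and "w \<noteq> []" and ov: "\<not> words_overlap w v"
  shows "inj_on (mixed_erase \<theta> w) (complete_return_words S {w, v})"
proof -
  let ?C = "complete_return_words S {w, v}"
  have len: "length v = length w" by (simp add: v word_inv_def)
  have "v \<noteq> w" using ov \<open>w \<noteq> []\<close> by (auto simp: words_overlap_def)
  have "v \<noteq> []" using len \<open>w \<noteq> []\<close> by auto
  have int: False if h: "u @ x @ z \<in> ?C" "x = w \<or> x = v" "u \<noteq> []" "z \<noteq> []" for u x z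
    using h internal_factorI[of u z x] by (auto simp: complete_return_words_def)
  \<comment> \<open>The digits in these names refer to the four cases of
    \<open>mixed_erase_cases\<close>: one \<open>n\<close> cannot arise from both. Here the suffix
    \<open>w\<close> of \<open>w @ n\<close> is internal in \<open>w @ n @ v\<close>.\<close>
  have n12: False if h: "w @ n @ v \<in> ?C" "suffix w (w @ n)" "n \<noteq> []" for n
  proof -
    obtain k where "w @ n = k @ w" using h(2) by (auto simp: suffix_def)
    moreover from this have "k \<noteq> []" using h(3) by (metis append_Nil append_self_conv)
    ultimately show False
      using int[of k w v] h(1) \<open>v \<noteq> []\<close> by (metis append_assoc)
  qed
  have n42: False if h: "w @ n @ v \<in> ?C" "prefix v (n @ v)" "n \<noteq> []" for n
  proof -
    obtain k where "n @ v = v @ k" using h(2) by (auto simp: prefix_def)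
    moreover from this have "k \<noteq> []" using h(3) by auto
    ultimately show False
      using int[of w v k] h(1) \<open>w \<noteq> []\<close> by simp
  qed
  have n13: False if h: "w @ n \<in> ?C" "prefix v n" "suffix w n" for n
  proof -
    obtain k where k: "n = v @ k" using h(2) by (auto simp: prefix_def)
    have "k \<noteq> []" using h(3) k len \<open>v \<noteq> w\<close> suffix_same_length[of v v w] by auto
    then show False using int[of w v k] h(1) k \<open>w \<noteq> []\<close> by simp
  qed
  have n43: False if h: "n @ v \<in> ?C" "prefix v n" "suffix w n" for n
  proof -
    obtain k where k: "n = k @ w" using h(3) by (auto simp: suffix_def)
    have "k \<noteq> []" using h(2) k len \<open>v \<noteq> w\<close> by (auto simp: prefix_def)
    then show False using int[of k w v] h(1) k \<open>v \<noteq> []\<close> by simp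
  qed
  have n23: False if h: "w @ n @ v \<in> ?C" "prefix v n" for n
  proof -
    obtain k where "n = v @ k" using h(2) by (auto simp: prefix_def)
    then show False using int[of w v "k @ v"] h(1) \<open>w \<noteq> []\<close> \<open>v \<noteq> []\<close> by simp
  qed
  \<comment> \<open>If \<open>n\<close> is at least as long as \<open>w\<close>, then it has prefix
    \<open>v\<close> and suffix \<open>w\<close>, which \<open>n43\<close> excludes. A shorter
    \<open>n\<close> is a suffix of \<open>w\<close> and a prefix of \<open>v\<close>.\<close>
  have n14: False if h: "n @ v \<in> ?C" "prefix v (n @ v)" "suffix w (w @ n)" "n \<noteq> []" for n
  proof (cases "length n \<ge> length w")
    case True
    have "prefix v n" using h(2) True len
      by (metis prefix_length_prefix prefixI)
    moreover have "suffix w n" using h(3) True by (metis suffix_length_suffix suffixI)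
    ultimately show False using n43 h(1) by blast
  next
    case False
    then have "suffix n w" using h(3) by (metis nat_le_linear suffix_length_suffix suffixI)
    moreover have "prefix n v" using h(2) False len
      by (metis nat_le_linear prefix_length_prefix prefixI)
    ultimately show False using ov h(4) by (auto simp: words_overlap_def)
  qed
  show ?thesis
  proof (rule inj_onI)
    fix u u' assume u: "u \<in> ?C" "u' \<in> ?C" and eq: "mixed_erase \<theta> w u = mixed_erase \<theta> w u'"
    define n where "n = mixed_erase \<theta> w u"
    define P1 where "P1 \<longleftrightarrow> w @ n \<in> ?C \<and> suffix w (w @ n) \<and> n \<noteq> []"
    define P2 where "P2 \<longleftrightarrow> w @ n @ v \<in> ?C"
    define P3 where "P3 \<longleftrightarrow> n \<in> ?C \<and> prefix v n \<and> suffix w n"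
    define P4 where "P4 \<longleftrightarrow> n @ v \<in> ?C \<and> prefix v (n @ v) \<and> n \<noteq> []"
    note P = P1_def P2_def P3_def P4_def
    have shape: "x = w @ n \<and> P1 \<or> x = w @ n @ v \<and> P2 \<or> x = n \<and> P3 \<or> x = n @ v \<and> P4"
      if x: "x \<in> ?C" "mixed_erase \<theta> w x = n" for x
      using mixed_erase_cases[OF x(1) assms] x(1) unfolding x(2) P by metis
    \<comment> \<open>So \<open>u\<close> and \<open>u'\<close> fall under the same case, and within
      one case \<open>n\<close> determines the word.\<close>
    have excl: "\<not> (P1 \<and> P2)" "\<not> (P1 \<and> P3)" "\<not> (P1 \<and> P4)" "\<not> (P2 \<and> P3)" "\<not> (P2 \<and> P4)" "\<not> (P3 \<and> P4)"
      unfolding P using n12[of n] n13[of n] n14[of n] n23[of n] n42[of n] n43[of n] by argo+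
    show "u = u'"
      using shape[OF u(1) n_def[symmetric]] shape[OF u(2) trans[OF eq[symmetric] n_def[symmetric]]] excl
      by (elim disjE conjE; simp)
  qed
qed

theorem theorem6p12:
  fixes A :: "'a set" and \<theta> :: "'a \<Rightarrow> 'a" and S :: "'a list set" and w :: "'a list"
  assumes "finite A"
    and "involution_on A \<theta>"
    and "recurrent_set A S"
    and "specular_set A \<theta> S"
    and "w \<in> S"
    and "w \<noteq> []"
    and "\<not> words_overlap w (word_inv \<theta> w)"
  shows "card (mixed_return_words \<theta> S w) = card A"
proof -
  define v where "v = word_inv \<theta> w"
  have ov: "\<not> words_overlap w v" using assms(7) by (simp add: v_def)
  \<comment> \<open>A nonempty word overlaps itself.\<close>
  then have "v \<noteq> w" using assms(6) by (auto simp: words_overlap_def)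
  have "v \<in> S" using assms(4,5) by (simp add: v_def specular_set_def laminary_set_def)
  interpret tree_return_words A 2 S "{w, v}" "length w"
    using assms \<open>v \<in> S\<close> by unfold_locales (auto simp: specular_set_def v_def word_inv_def)
  \<comment> \<open>The characteristic 2 cancels against the two elements of
    \<open>{w, v}\<close>.\<close>
  have "card (complete_return_words S {w, v}) = card A"
    using card_complete_return_words \<open>v \<noteq> w\<close> by simp
  then show ?thesis
    using card_image[OF inj_on_mixed_erase[OF v_def assms(6) ov]]
    by (simp add: mixed_return_words_def v_def)
qed

end
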